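(* Let $F=(f_{ij})_{1\le i,j\le 4}$ be a lift of the $4\times4$ identity valuation pattern over a valued field with residue field $k$, and let $u_{ij}\in k^*$ be the residue of $f_{ij}$ for $i\ne j$. Let $D_4\subset S_4$ be the set of derangements and $$\Theta_4(U):=\sum_{\sigma\in D_4}\mathrm{sgn}(\sigma)\prod_{i=1}^4 u_{i,\sigma(i)}.$$ Then $\det(F)=\Theta_4(U)+(\text{terms of valuation}>0)$, i.e. $\det(F)$ lies in the valuation ring and its residue in $k$ is $\Theta_4(U)$; hence $$\mathrm{val}(\det F)>0\iff \Theta_4(U)=0 .$$ In particular, for every lift of rank at most $3$ of a matrix, each $4\times4$ minor of it having the identity valuation pattern satisfies the $9$-term residue cancellation equation $\Theta_4(U)=0$.
   Context: $(K,\mathrm{val})$ is a non-archimedean valued field with value group in $\mathbb R$, valuation ring $R_K=\{x:\mathrm{val}(x)\ge0\}$, maximal ideal $\mathfrak m_K=\{x:\mathrm{val}(x)>0\}$ and residue field $k=R_K/\mathfrak m_K$ (with $\mathrm{val}(0)=\infty$). A lift of a real matrix $A$ is a matrix over $K$ whose entrywise valuation is $A$. A lift of the $4\times4$ identity valuation pattern is a matrix $F=(f_{ij})\in K^{4\times4}$ with $\mathrm{val}(f_{ii})=1$ for all $i$ and $\mathrm{val}(f_{ij})=0$ for $i\ne j$. *)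

theory Defs
  imports "HOL-Analysis.Analysis" "HOL-Algebra.QuotRing"
begin

locale valued_field =
  fixes val :: "'a::field \<Rightarrow> ereal"
  assumes val_not_MInf: "val x \<noteq> -\<infinity>"
    and val_eq_PInf_iff: "val x = \<infinity> \<longleftrightarrow> x = 0"
    and val_mult: "val (x * y) = val x + val y"
    and val_add: "min (val x) (val y) \<le> val (x + y)"

definition valuation_ring :: "('a::field \<Rightarrow> ereal) \<Rightarrow> 'a ring" where
  "valuation_ring val =
    \<lparr>carrier = {x. 0 \<le> val x}, mult = (*), one = 1, zero = 0, add = (+)\<rparr>"

definition valuation_ideal :: "('a::field \<Rightarrow> ereal) \<Rightarrow> 'a set" where
  "valuation_ideal val = {x. 0 < val x}"

definition residue_field :: "('a::field \<Rightarrow> ereal) \<Rightarrow> 'a set ring" where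
  "residue_field val = valuation_ring val Quot valuation_ideal val"

text \<open>The residue class of \<open>x\<close>; only meaningful for \<open>x\<close> in the valuation ring.\<close>

definition residue_class :: "('a::field \<Rightarrow> ereal) \<Rightarrow> 'a \<Rightarrow> 'a set" where
  "residue_class val x = valuation_ideal val +>\<^bsub>valuation_ring val\<^esub> x"

definition is_lift :: "('a::field \<Rightarrow> ereal) \<Rightarrow> 'a^'n^'m \<Rightarrow> real^'n^'m \<Rightarrow> bool" where
  "is_lift val F A \<longleftrightarrow> (\<forall>i j. val (F $ i $ j) = ereal (A $ i $ j))"

definition derangements4 :: "(4 \<Rightarrow> 4) set" where
  "derangements4 = {\<sigma>. \<sigma> permutes UNIV \<and> (\<forall>i. \<sigma> i \<noteq> i)}"

text \<open>The diagonal of \<open>U\<close> does not enter the sum.  \<open>[n] \<cdot> x\<close> is the integer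
  multiple in \<open>k\<close>.\<close>

definition Theta4 :: "('k, 'b) ring_scheme \<Rightarrow> (4 \<Rightarrow> 4 \<Rightarrow> 'k) \<Rightarrow> 'k" where
  "Theta4 k U =
    (\<Oplus>\<^bsub>k\<^esub>\<sigma>\<in>derangements4. [sign \<sigma>] \<cdot>\<^bsub>k\<^esub> (\<Otimes>\<^bsub>k\<^esub>i\<in>UNIV. U i (\<sigma> i)))"

end

(*
  Every non-derangement in the Leibniz expansion of det F picks up a diagonal entry, hence has
  positive valuation and dies in the residue field; applying the residue homomorphism to the
  remaining nine terms yields Theta_4(U). A 4x4 minor of a matrix of rank at most 3 vanishes,
  so its residue does too.
*)

theory Submission
  imports Defs
begin

section \<open>Nonsingular submatrices and rank\<close>

text \<open>A linear relation among the selected full rows restricts to a relation among the rows of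
  the submatrix, which are independent. So \<open>G\<close> has \<open>CARD('k)\<close> independent
  rows. The contrapositive makes the minors of low-rank matrices vanish.\<close>

lemma CARD_le_rank_if_det_submatrix_nonzero:
  fixes G :: "'a::field^'n^'m" and r :: "'k::finite \<Rightarrow> 'm" and c :: "'k \<Rightarrow> 'n"
  assumes "det (\<chi> i j. G $ r i $ c j) \<noteq> 0"
  shows "CARD('k) \<le> rank G"
proof -
  define M :: "'a^'k^'k" where "M = (\<chi> i j. G $ r i $ c j)"
  define h where "h i = row (r i) G" for i
  have det: "det M \<noteq> 0" using assms by (simp add: M_def)
  have M_coeff: "row i M $ j = h i $ c j" for i j by (simp add: M_def h_def row_def)
  have zero: "a i = 0" if "(\<Sum>i\<in>UNIV. a i *s h i) = 0" for a i
  proof -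
    have "(\<Sum>i\<in>UNIV. a i *s row i M) $ j = (\<Sum>i\<in>UNIV. a i *s h i) $ c j" for j
      by (simp add: M_coeff)
    then have "(\<Sum>i\<in>UNIV. a i *s row i M) = 0"
      using that by (simp add: vec_eq_iff)
    \<comment> \<open>A right inverse is equivalent to independence of the rows of
      \<open>M\<close>.\<close>
    moreover have "\<exists>B. M ** B = mat 1"
      using det invertible_det_nz invertible_right_inverse by blast
    ultimately show "a i = 0"
      by (simp add: matrix_right_invertible_independent_rows)
  qed
  \<comment> \<open>Independence concerns the set \<open>range h\<close>, so coinciding rows must be
    excluded; they would make two rows of \<open>M\<close> equal and its determinant zero.\<close>
  have inj: "inj h"
  proof (rule injI, rule ccontr)
    fix i j assume "h i = h j" "i \<noteq> j"
    then have "row i M = row j M" by (simp add: vec_eq_iff M_coeff)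
    with \<open>i \<noteq> j\<close> det show False by (metis det_identical_rows)
  qed
  have "vec.independent (range h)"
  proof (rule vec.independent_if_scalars_zero)
    fix f x assume "(\<Sum>x\<in>range h. f x *s x) = 0" and "x \<in> range h"
    then have "(\<Sum>i\<in>UNIV. f (h i) *s h i) = 0"
      using inj by (simp add: sum.reindex)
    from zero[OF this] \<open>x \<in> range h\<close> show "f x = 0" by auto
  qed simp
  moreover have "range h \<subseteq> rows G" by (auto simp: h_def rows_def)
  ultimately have "card (range h) \<le> rank G"
    unfolding row_rank_def_gen by (rule vec.independent_card_le_dim[rotated])
  with inj show ?thesis by (simp add: card_image)
qed

section \<open>Elementary properties of valuations\<close>

context valued_field
begin

lemma val_0 [simp]: "val 0 = \<infinity>"
  by (simp add: val_eq_PInf_iff)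

lemma val_1 [simp]: "val 1 = 0"
  using val_mult[of 1 1] val_not_MInf[of 1] val_eq_PInf_iff[of 1]
  by (cases "val 1") auto

text \<open>Since -1 squares to 1, twice its valuation is 0, and in \<open>ereal\<close> this forces
  the valuation itself to be 0.\<close>

lemma val_uminus [simp]: "val (- x) = val x"
proof -
  have "val (-1) + val (-1) = 0" using val_mult[of "-1" "-1"] by simp
  then have "val (-1) = 0" by (cases "val (-1)") auto
  then show ?thesis using val_mult[of "-1" x] by simp
qed

lemma val_inverse_eq_0: "val x = 0 \<Longrightarrow> val (inverse x) = 0"
  using val_mult[of x "inverse x"] val_eq_PInf_iff[of x] by (cases "x = 0") auto

lemma val_prod: "val (prod f A) = (\<Sum>x\<in>A. val (f x))"
  by (induction A rule: infinite_finite_induct) (simp_all add: val_mult)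

lemma val_add_nonneg: "0 \<le> val x \<Longrightarrow> 0 \<le> val y \<Longrightarrow> 0 \<le> val (x + y)"
  using val_add[of x y] by (auto simp: min_def split: if_splits)

lemma val_add_pos: "0 < val x \<Longrightarrow> 0 < val y \<Longrightarrow> 0 < val (x + y)"
  using val_add[of x y] by (auto simp: min_def split: if_splits)

lemma val_sum_nonneg: "(\<And>x. x \<in> A \<Longrightarrow> 0 \<le> val (f x)) \<Longrightarrow> 0 \<le> val (sum f A)"
  by (induction A rule: infinite_finite_induct) (simp_all add: val_add_nonneg)

text \<open>The strict bound survives empty and infinite index sets, where the sum is 0 and has
  valuation \<infinity>.\<close>

lemma val_sum_pos: "(\<And>x. x \<in> A \<Longrightarrow> 0 < val (f x)) \<Longrightarrow> 0 < val (sum f A)"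
  by (induction A rule: infinite_finite_induct) (simp_all add: val_add_pos)

lemma val_sign_mult [simp]: "val (of_int (sign p) * x) = val x"
  by (cases p rule: sign_cases) simp_all

section \<open>The valuation ring as an algebraic structure\<close>

lemma cring_valuation_ring: "cring (valuation_ring val)"
proof (rule cringI)
  show "abelian_group (valuation_ring val)"
  proof (rule abelian_groupI)
    fix x assume "x \<in> carrier (valuation_ring val)"
    then show "\<exists>y\<in>carrier (valuation_ring val).
        y \<oplus>\<^bsub>valuation_ring val\<^esub> x = \<zero>\<^bsub>valuation_ring val\<^esub>"
      by (intro bexI[of _ "- x"]) (simp_all add: valuation_ring_def)
  qed (simp_all add: valuation_ring_def val_add_nonneg algebra_simps)
  show "comm_monoid (valuation_ring val)"
    by (rule comm_monoidI) (simp_all add: valuation_ring_def val_mult algebra_simps)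
qed (simp add: valuation_ring_def algebra_simps)

sublocale R: cring "valuation_ring val"
  by (rule cring_valuation_ring)

lemma carrier_valuation_ring [simp]: "x \<in> carrier (valuation_ring val) \<longleftrightarrow> 0 \<le> val x"
  and zero_valuation_ring [simp]: "\<zero>\<^bsub>valuation_ring val\<^esub> = 0"
  and one_valuation_ring [simp]: "\<one>\<^bsub>valuation_ring val\<^esub> = 1"
  and add_valuation_ring [simp]: "x \<oplus>\<^bsub>valuation_ring val\<^esub> y = x + y"
  and mult_valuation_ring [simp]: "x \<otimes>\<^bsub>valuation_ring val\<^esub> y = x * y"
  by (simp_all add: valuation_ring_def)

lemma a_inv_valuation_ring: "0 \<le> val x \<Longrightarrow> \<ominus>\<^bsub>valuation_ring val\<^esub> x = - x"
  by (rule R.minus_equality) simp_all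

text \<open>On an infinite index set both sums take the default value 0, so they agree there as
  well.\<close>

lemma finsum_valuation_ring:
  "(\<And>x. x \<in> A \<Longrightarrow> 0 \<le> val (f x)) \<Longrightarrow> finsum (valuation_ring val) f A = sum f A"
  by (induction A rule: infinite_finite_induct)
    (simp_all add: R.finsum_infinite Pi_def)

lemma finprod_valuation_ring:
  "(\<And>x. x \<in> A \<Longrightarrow> 0 \<le> val (f x)) \<Longrightarrow> finprod (valuation_ring val) f A = prod f A"
  by (induction A rule: infinite_finite_induct)
    (simp_all add: R.finprod_infinite Pi_def)

section \<open>The maximal ideal and the residue map\<close>

lemma ideal_valuation_ideal: "ideal (valuation_ideal val) (valuation_ring val)"
proof (rule idealI)
  show "subgroup (valuation_ideal val) (add_monoid (valuation_ring val))"
  proof (rule R.add.subgroupI)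
    fix a assume "a \<in> valuation_ideal val"
    then show "\<ominus>\<^bsub>valuation_ring val\<^esub> a \<in> valuation_ideal val"
      by (simp add: valuation_ideal_def a_inv_valuation_ring)
  qed (auto simp: valuation_ideal_def val_add_pos intro!: exI[of _ 0])
qed (auto simp: valuation_ideal_def val_mult R.ring_axioms add_pos_nonneg add_nonneg_pos)

sublocale I: ideal "valuation_ideal val" "valuation_ring val"
  by (rule ideal_valuation_ideal)

text \<open>As a homomorphism of commutative rings, reduction commutes with the finite sums,
  products and negations of the Leibniz expansion.\<close>

sublocale residue: ring_hom_cring "valuation_ring val" "residue_field val" "residue_class val"
proof -
  have "residue_class val = (+>\<^bsub>valuation_ring val\<^esub>) (valuation_ideal val)"
    by (simp add: fun_eq_iff residue_class_def)
  then show "ring_hom_cring (valuation_ring val) (residue_field val) (residue_class val)"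
    using I.rcos_ring_hom_cring[OF cring_valuation_ring] by (simp add: residue_field_def)
qed

text \<open>The zero of the quotient is the ideal itself, and a coset equals it exactly when its
  representative lies in the ideal.\<close>

lemma residue_class_eq_zero_iff:
  assumes "0 \<le> val x"
  shows "residue_class val x = \<zero>\<^bsub>residue_field val\<^esub> \<longleftrightarrow> 0 < val x"
proof -
  have "residue_class val x = \<zero>\<^bsub>residue_field val\<^esub> \<longleftrightarrow> x \<in> valuation_ideal val"
    using assms I.rcos_const_imp_mem[of x] I.a_rcos_const[of x]
    by (auto simp: residue_class_def residue_field_def FactRing_def)
  then show ?thesis by (simp add: valuation_ideal_def)
qed

text \<open>The inverse of \<open>x\<close> also has valuation 0, hence lies in the ring, and its
  residue inverts that of \<open>x\<close>.\<close>

lemma residue_class_Units: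
  assumes "val x = 0"
  shows "residue_class val x \<in> Units (residue_field val)"
proof -
  have "x \<noteq> 0" using assms by auto
  moreover have "val (inverse x) = 0" by (rule val_inverse_eq_0[OF assms])
  ultimately have
    "residue_class val (inverse x) \<otimes>\<^bsub>residue_field val\<^esub> residue_class val x
      = \<one>\<^bsub>residue_field val\<^esub>"
    "residue_class val x \<otimes>\<^bsub>residue_field val\<^esub> residue_class val (inverse x)
      = \<one>\<^bsub>residue_field val\<^esub>"
    "residue_class val x \<in> carrier (residue_field val)"
    "residue_class val (inverse x) \<in> carrier (residue_field val)"
    using assms residue.hom_mult[of "inverse x" x] residue.hom_mult[of x "inverse x"]
      residue.hom_one by simp_all
  then show ?thesis
    unfolding Units_def by blast
qed

text \<open>Converts the sign factor in the field into the integer multiple used by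
  \<open>Theta4\<close>.\<close>

lemma residue_class_sign_mult:
  assumes "0 \<le> val x"
  shows "residue_class val (of_int (sign p) * x)
    = [sign p] \<cdot>\<^bsub>residue_field val\<^esub> residue_class val x"
proof (cases p rule: sign_cases)
  case even
  then show ?thesis
    using assms by (simp add: residue.S.add.int_pow_1)
next
  case odd
  have "residue_class val (- x) = \<ominus>\<^bsub>residue_field val\<^esub> residue_class val x"
    using assms residue.hom_a_inv[of x] by (simp add: a_inv_valuation_ring)
  \<comment> \<open>A negative integer multiple unfolds to the negation of a natural multiple, here
    with factor 1.\<close>
  then show ?thesis
    using assms odd by (simp add: add_pow_int_lt)
qed

lemma residue_class_sum:
  "(\<And>x. x \<in> A \<Longrightarrow> 0 \<le> val (f x)) \<Longrightarrow>
    residue_class val (sum f A) = (\<Oplus>\<^bsub>residue_field val\<^esub>x\<in>A. residue_class val (f x))"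
  using residue.hom_finsum[of f A] finsum_valuation_ring[of A f] by (simp add: Pi_def o_def)

lemma residue_class_prod:
  "(\<And>x. x \<in> A \<Longrightarrow> 0 \<le> val (f x)) \<Longrightarrow>
    residue_class val (prod f A) = (\<Otimes>\<^bsub>residue_field val\<^esub>x\<in>A. residue_class val (f x))"
  using residue.hom_finprod[of f A] finprod_valuation_ring[of A f] by (simp add: Pi_def o_def)

section \<open>Determinants of lifts of the identity pattern\<close>

context
  fixes F :: "'a^4^4"
  assumes lift: "is_lift val F (mat 1)"
begin

lemma val_lift_identity: "val (F $ i $ j) = (if i = j then 1 else 0)"
  using lift by (simp add: is_lift_def mat_def one_ereal_def zero_ereal_def)

lemma val_lift_identity_prod_nonneg: "0 \<le> val (\<Prod>i\<in>UNIV. F $ i $ \<sigma> i)"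
  by (simp add: val_prod val_lift_identity sum_nonneg)

text \<open>The fixed point contributes a diagonal entry of valuation 1, which the other factors
  cannot offset because their valuations are nonnegative.\<close>

lemma val_lift_identity_prod_pos:
  assumes "\<sigma> i = i"
  shows "0 < val (\<Prod>i\<in>UNIV. F $ i $ \<sigma> i)"
proof -
  have "0 < val (F $ i $ \<sigma> i)"
    using assms by (simp add: val_lift_identity)
  \<comment> \<open>Written as a singleton sum, the term can be compared by enlarging the index
    set.\<close>
  also have "\<dots> = (\<Sum>j\<in>{i}. val (F $ j $ \<sigma> j))"
    by simp
  also have "\<dots> \<le> (\<Sum>j\<in>UNIV. val (F $ j $ \<sigma> j))"
    by (rule sum_mono2) (simp_all add: val_lift_identity)
  finally show ?thesis
    by (simp only: val_prod)
qed

lemma val_det_lift_identity_nonneg: "0 \<le> val (det F)"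
  unfolding det_def by (rule val_sum_nonneg) (simp add: val_lift_identity_prod_nonneg)

text \<open>All Leibniz terms lie in the ring, so reduction acts term by term. Knowing
  \<open>U\<close> off the diagonal suffices, as derangements select only such entries.\<close>

lemma residue_class_det_lift_identity:
  assumes U: "\<And>i j. i \<noteq> j \<Longrightarrow> U i j = residue_class val (F $ i $ j)"
  shows "residue_class val (det F) = Theta4 (residue_field val) U"
proof -
  define t where "t \<sigma> = of_int (sign \<sigma>) * (\<Prod>i\<in>UNIV. F $ i $ \<sigma> i)" for \<sigma>
  \<comment> \<open>\<open>N\<close> consists of the permutations with at least one fixed
    point.\<close>
  define N where "N = {\<sigma>. \<sigma> permutes (UNIV :: 4 set)} - derangements4"
  have t_nonneg: "0 \<le> val (t \<sigma>)" for \<sigma>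
    by (simp add: t_def val_lift_identity_prod_nonneg)
  have N_pos: "0 < val (sum t N)"
    by (rule val_sum_pos)
      (auto simp: N_def t_def derangements4_def val_lift_identity_prod_pos)
  have "det F = sum t N + sum t derangements4"
    unfolding det_def N_def t_def[symmetric]
    by (rule sum.subset_diff) (auto simp: derangements4_def finite_permutations)
  moreover have "residue_class val (sum t N) = \<zero>\<^bsub>residue_field val\<^esub>"
    using N_pos by (simp add: residue_class_eq_zero_iff)
  ultimately have "residue_class val (det F) = residue_class val (sum t derangements4)"
    using residue.hom_add[of "sum t N" "sum t derangements4"] N_pos t_nonneg
    by (simp add: val_sum_nonneg)
  also have "\<dots> = (\<Oplus>\<^bsub>residue_field val\<^esub>\<sigma>\<in>derangements4. residue_class val (t \<sigma>))"
    by (rule residue_class_sum) (rule t_nonneg)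
  also have "\<dots> = Theta4 (residue_field val) U"
    unfolding Theta4_def
  proof (rule residue.S.finsum_cong'[OF refl])
    have term_eq: "residue_class val (t \<sigma>) = [sign \<sigma>] \<cdot>\<^bsub>residue_field val\<^esub>
        (\<Otimes>\<^bsub>residue_field val\<^esub>i\<in>UNIV. U i (\<sigma> i))" if "\<sigma> \<in> derangements4" for \<sigma>
    proof -
      have "U i (\<sigma> i) = residue_class val (F $ i $ \<sigma> i)" for i
        using that by (intro U) (auto simp: derangements4_def dest!: spec[of _ i])
      then show ?thesis
        by (simp add: t_def residue_class_sign_mult val_lift_identity_prod_nonneg
            residue_class_prod val_lift_identity)
    qed
    then show "residue_class val (t \<sigma>) = [sign \<sigma>] \<cdot>\<^bsub>residue_field val\<^esub>
        (\<Otimes>\<^bsub>residue_field val\<^esub>i\<in>UNIV. U i (\<sigma> i))" if "\<sigma> \<in> derangements4" for \<sigma>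
      using that .
    \<comment> \<open>The congruence rule asks for closure; it follows by reading each term as the
      residue of the ring element \<open>t \<sigma>\<close>.\<close>
    show "(\<lambda>\<sigma>. [sign \<sigma>] \<cdot>\<^bsub>residue_field val\<^esub> (\<Otimes>\<^bsub>residue_field val\<^esub>i\<in>UNIV. U i (\<sigma> i)))
        \<in> derangements4 \<rightarrow> carrier (residue_field val)"
      by (rule Pi_I, subst term_eq[symmetric]) (simp_all add: t_nonneg)
  qed
  finally show ?thesis .
qed

end

end

theorem proposition4p2:
  fixes val :: "'a::field \<Rightarrow> ereal"
  assumes "valued_field val"
  shows
    "(\<forall>(F :: 'a^4^4) (U :: 4 \<Rightarrow> 4 \<Rightarrow> 'a set).
        is_lift val F (mat 1) \<longrightarrow>
        (\<forall>i j. i \<noteq> j \<longrightarrow> U i j = residue_class val (F $ i $ j)) \<longrightarrow>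
          (\<forall>i j. i \<noteq> j \<longrightarrow> U i j \<in> Units (residue_field val)) \<and>
          det F \<in> carrier (valuation_ring val) \<and>
          residue_class val (det F) = Theta4 (residue_field val) U \<and>
          (0 < val (det F) \<longleftrightarrow> Theta4 (residue_field val) U = \<zero>\<^bsub>residue_field val\<^esub>)) \<and>
     (\<forall>(A :: real^'n^'m) (G :: 'a^'n^'m) (r :: 4 \<Rightarrow> 'm) (c :: 4 \<Rightarrow> 'n) (U :: 4 \<Rightarrow> 4 \<Rightarrow> 'a set).
        is_lift val G A \<longrightarrow> rank G \<le> 3 \<longrightarrow> inj r \<longrightarrow> inj c \<longrightarrow>
        (\<chi> i j. A $ r i $ c j) = (mat 1 :: real^4^4) \<longrightarrow>
        (\<forall>i j. i \<noteq> j \<longrightarrow> U i j = residue_class val (G $ r i $ c j)) \<longrightarrow>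
          Theta4 (residue_field val) U = \<zero>\<^bsub>residue_field val\<^esub>)"
proof -
  interpret valued_field val by fact
  show ?thesis
  proof (intro conjI allI impI)
    fix F :: "'a^4^4" and U
    assume F: "is_lift val F (mat 1)"
      and U: "\<forall>i j. i \<noteq> j \<longrightarrow> U i j = residue_class val (F $ i $ j)"
    show "U i j \<in> Units (residue_field val)" if "i \<noteq> j" for i j
      using that U by (simp add: residue_class_Units val_lift_identity[OF F])
    show "det F \<in> carrier (valuation_ring val)"
      by (simp add: val_det_lift_identity_nonneg[OF F])
    show residue: "residue_class val (det F) = Theta4 (residue_field val) U"
      using U by (intro residue_class_det_lift_identity[OF F]) simp
    show "0 < val (det F) \<longleftrightarrow> Theta4 (residue_field val) U = \<zero>\<^bsub>residue_field val\<^esub>"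
      using residue_class_eq_zero_iff[OF val_det_lift_identity_nonneg[OF F]]
      by (simp add: residue)
  next
    fix A :: "real^'n^'m" and G :: "'a^'n^'m" and r c U
    assume G: "is_lift val G A" and rank: "rank G \<le> 3"
      and minor: "(\<chi> i j. A $ r i $ c j) = (mat 1 :: real^4^4)"
      and U: "\<forall>i j. i \<noteq> j \<longrightarrow> U i j = residue_class val (G $ r i $ c j)"
    define M :: "'a^4^4" where "M = (\<chi> i j. G $ r i $ c j)"
    \<comment> \<open>Selecting rows and columns commutes with taking valuations entrywise.\<close>
    have "is_lift val M (mat 1)"
      using G unfolding minor[symmetric] by (simp add: is_lift_def M_def)
    then have "residue_class val (det M) = Theta4 (residue_field val) U"
      using U by (intro residue_class_det_lift_identity) (simp_all add: M_def)
    \<comment> \<open>A nonzero minor would give 4 \<le> \<open>rank G\<close>, against the bound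
      3.\<close>
    moreover have "det M = 0"
      using CARD_le_rank_if_det_submatrix_nonzero[of G r c] rank by (auto simp: M_def)
    \<comment> \<open>The residue of 0 vanishes because its valuation \<infinity> is
      positive.\<close>
    ultimately show "Theta4 (residue_field val) U = \<zero>\<^bsub>residue_field val\<^esub>"
      using residue_class_eq_zero_iff[of 0] by simp
  qed
qed

end
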